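(* Let $\Phi:[0,\infty)\to[0,\infty)$ be convex and nondecreasing. For every $n\in\mathbb{N}$, let there exist an integer-valued random variable $U_n=\mathfrak{u}(\mathbf{Z}_n)$ (with $\mathfrak{u}:\mathcal{X}_n\times\mathcal{X}_n\to\mathbb{Z}$, depending on $n$), a set $\mathcal{U}_n=\{u_1<u_2<\cdots<u_{m(n)}\}\subset\mathcal{S}_n$, where $\mathcal{S}_n$ is the support of $U_n$, and a random transformation $\mathcal{R}$ on $\mathcal{X}_n\times\mathcal{X}_n$ such that, for all consecutive elements $u_i,u_{i+1}\in\mathcal{U}_n$ and all $\mathbf{z}_n\in\mathcal{X}_n\times\mathcal{X}_n$, $$\mathbb{P}\left(\mathcal{R}(\mathbf{Z}_n)=\mathbf{z}_n\,|\,U_n=u_i\right)=\mathbb{P}\left(\mathbf{Z}_n=\mathbf{z}_n\,|\,U_n=u_{i+1}\right).$$ Assume moreover that: (i) there exists a constant $A>0$, independent of $n$, such that $L_n(\mathcal{R}(\mathbf{Z}_n))-L_n(\mathbf{Z}_n)\geq -A$; (ii) there exists a constant $\varepsilon_0>0$, independent of $n$, such that $\Delta_n(\varepsilon_0)=o(\varphi(n))$ as $n\to\infty$, where $$\Delta_n(\varepsilon_0):=\mathbb{P}\left(\mathbb{E}\left(L_n(\mathcal{R}(\mathbf{Z}_n))-L_n(\mathbf{Z}_n)\,|\,\mathbf{Z}_n\right)<\varepsilon_0\right),$$ and where $\varphi$ is a positive function on $\mathbb{N}$ such that $\mathbb{P}(U_n=u)\geq\varphi(n)$ for all $u\in\mathcal{U}_n$.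 Then there exists $a_n\in[u_1,u_{m(n)}]$ such that, for all $n$ large enough, $$\mathbb{E}\left(\Phi\left(|L_n(\mathbf{Z}_n)-\mu_n|\right)\right)\geq\sum_{u_i\in\mathcal{U}_n}\Phi\left(\frac{\delta}{k_0}|u_i-a_n|\right)\mathbb{P}(U_n=u_i)\geq\sum_{u_i\in\mathcal{U}_n}\Phi\left(\frac{\delta}{k_0}|u_i-a_n|\right)\varphi(n),$$ where $\delta=\varepsilon_0/2$, $k_0=k_0(n)=\max_{i=1,\ldots,m(n)-1}(u_{i+1}-u_i)$ and $\mu_n=\mathbb{E}(L_n(\mathbf{Z}_n))$.
   Context: For each $n$, $\mathbf{X}_n=(X_1,\ldots,X_n)$ and $\mathbf{Y}_n=(Y_1,\ldots,Y_n)$ are independent, identically distributed random strings with letters in a fixed finite alphabet $\mathcal{A}$; $\mathcal{X}_n\subseteq\mathcal{A}^n$ is their common sample space, and $\mathbf{Z}_n=(\mathbf{X}_n,\mathbf{Y}_n)$. Let $S:\mathcal{A}\times\mathcal{A}\to[0,\infty)$ be a symmetric scoring function and $\theta\in\mathbb{R}$ a constant gap price. An alignment is a pair $(\boldsymbol\pi,\boldsymbol\mu)$ of increasing integer sequences $1\leq\pi_1<\cdots<\pi_k\leq n$, $1\leq\mu_1<\cdots<\mu_k\leq n$ of the same length $k$. Its score for $\mathbf{Z}_n$ is $\sum_{i=1}^k S(X_{\pi_i},Y_{\mu_i})+\theta(n-k)$. The optimal alignment score $L_n=L_n(\mathbf{Z}_n)$ is the maximum of the scores over all alignments. A random transformation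 is a map $\mathcal{R}:\Omega\times\mathcal{X}_n\times\mathcal{X}_n\to\mathcal{X}_n\times\mathcal{X}_n$, where $\Omega$ is a probability space carrying the extra randomness of $\mathcal{R}$, independent of $\mathbf{Z}_n$; $\mathcal{R}(\mathbf{Z}_n)$ denotes the resulting random element, and conditional expectation given $\mathbf{Z}_n$ averages over the randomness of $\mathcal{R}$. The inequality in (i) is meant for all outcomes. The sets $\mathcal{U}_n$ are assumed to have at least two elements, so that $k_0$ is defined. *)

theory Defs
  imports "HOL-Probability.Probability" "HOL-Library.Landau_Symbols"
begin

(* Positions are 1-based, as in the usual convention; the empty alignment (k = 0) is allowed. *)
definition alignments :: "nat \<Rightarrow> (nat list \<times> nat list) set" where
  "alignments n = {(p, q). length p = length q \<and>
      sorted_wrt (<) p \<and> set p \<subseteq> {1..n} \<and>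
      sorted_wrt (<) q \<and> set q \<subseteq> {1..n}}"

definition alignment_score ::
  "('a \<Rightarrow> 'a \<Rightarrow> real) \<Rightarrow> real \<Rightarrow> nat \<Rightarrow> 'a list \<times> 'a list \<Rightarrow> nat list \<times> nat list \<Rightarrow> real" where
  "alignment_score S \<theta> n = (\<lambda>(x, y) (p, q).
      (\<Sum>i<length p. S (x ! (p ! i - 1)) (y ! (q ! i - 1)))
      + \<theta> * (real n - real (length p)))"

(* The set of alignments is finite and nonempty, so Max is a genuine maximum. *)
definition optimal_score ::
  "('a \<Rightarrow> 'a \<Rightarrow> real) \<Rightarrow> real \<Rightarrow> nat \<Rightarrow> 'a list \<times> 'a list \<Rightarrow> real" where
  "optimal_score S \<theta> n z = Max (alignment_score S \<theta> n z ` alignments n)"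

(* A map \<Omega> \<times> E \<rightarrow> E for a probability space \<Omega> and a (finite) state space E. *)
definition random_transformation :: "'r measure \<Rightarrow> 's set \<Rightarrow> ('r \<Rightarrow> 's \<Rightarrow> 's) \<Rightarrow> bool" where
  "random_transformation \<Omega> E R \<longleftrightarrow> prob_space \<Omega> \<and>
     (\<lambda>(r, z). R r z) \<in> measurable (\<Omega> \<Otimes>\<^sub>M count_space E) (count_space E)"

(* The library's indep_var requires both random variables to have the same value type. *)
definition indep_elements ::
  "'w measure \<Rightarrow> 'b measure \<Rightarrow> ('w \<Rightarrow> 'b) \<Rightarrow> 'c measure \<Rightarrow> ('w \<Rightarrow> 'c) \<Rightarrow> bool" where
  "indep_elements M N1 V1 N2 V2 \<longleftrightarrow>
     prob_space.indep_set M {V1 -` B \<inter> space M | B. B \<in> sets N1}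
                            {V2 -` B \<inter> space M | B. B \<in> sets N2}"

(* E(f | Z) for a random element Z with values in the discrete space E, as the conditional
   expectation given the sigma-algebra generated by Z. *)
definition cond_exp_given ::
  "'w measure \<Rightarrow> 's set \<Rightarrow> ('w \<Rightarrow> 's) \<Rightarrow> ('w \<Rightarrow> real) \<Rightarrow> 'w \<Rightarrow> real" where
  "cond_exp_given M E Z f = real_cond_exp M (vimage_algebra (space M) Z (count_space E)) f"

(* Largest gap between consecutive terms of v 1 < ... < v m; intended for m \<ge> 2. *)
definition max_gap :: "nat \<Rightarrow> (nat \<Rightarrow> int) \<Rightarrow> int" where
  "max_gap m v = Max ((\<lambda>i. v (i + 1) - v i) ` {1..m - 1})"

end

theory Submission
  imports Defs
begin

text \<open>
  Let h(i) = E(L(Z) | U = u(i)). The shift property of R turns h(i+1) - h(i) into the conditional mean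
  of L(R(Z)) - L(Z) given U = u(i). Off an event of probability Delta its conditional expectation
  given Z is at least eps0, and it is never below -A, so the increment is at least
  eps0 - (eps0 + A) Delta / phi, which is eventually at least eps0/2. With c = delta/k0, the sequence
  h - c u is therefore nondecreasing, so the intervals with centre u(i) and radius |h(i) - mu| / c meet
  pairwise and, by Helly's theorem on the line, have a common point a in the range of u. Jensen's
  inequality on each event U = u(i), followed by monotonicity of Phi, gives the bound.
\<close>

section \<open>Intervals, telescoping and convexity on the real line\<close>

text \<open>Helly's theorem on the line for the closed intervals with centre \<open>x i\<close> and
  radius \<open>d i\<close>. By \<open>meet\<close>, every left endpoint lies below every right
  endpoint, so the largest left endpoint belongs to all intervals. The bounds on the centres allow
  the common point to be taken in \<open>{lo..hi}\<close> as well.\<close>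

lemma common_point_of_pairwise_meeting_intervals:
  fixes x d :: "'i \<Rightarrow> real"
  assumes "finite I" and "I \<noteq> {}" and "\<And>i. i \<in> I \<Longrightarrow> 0 \<le> d i"
    and range: "\<And>i. i \<in> I \<Longrightarrow> lo \<le> x i \<and> x i \<le> hi"
    and meet: "\<And>i j. i \<in> I \<Longrightarrow> j \<in> I \<Longrightarrow> x i - x j \<le> d i + d j"
  obtains a where "a \<in> {lo..hi}" and "\<And>i. i \<in> I \<Longrightarrow> \<bar>x i - a\<bar> \<le> d i"
proof
  let ?B = "(\<lambda>i. x i - d i) ` I"
  \<comment> \<open>The largest left endpoint, raised to \<open>lo\<close> if it falls below.
    Raising keeps it in every interval, since \<open>lo \<le> x i \<le> x i + d i\<close>.\<close>
  define a where "a = max lo (Max ?B)"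
  have B: "finite ?B" "?B \<noteq> {}"
    using assms by auto
  have "x i - d i \<le> hi" if "i \<in> I" for i
    using assms(3)[OF that] range[OF that] by linarith
  moreover have "lo \<le> hi"
    using assms(2) range by force
  ultimately show "a \<in> {lo..hi}"
    using B by (auto simp: a_def)
  show "\<bar>x i - a\<bar> \<le> d i" if i: "i \<in> I" for i
  proof -
    have "x i - d i \<le> Max ?B"
      using B i by auto
    moreover have "x j - d j \<le> x i + d i" if "j \<in> I" for j
      using meet[OF that i] by linarith
    then have "Max ?B \<le> x i + d i"
      using B by simp
    ultimately show ?thesis
      using assms(3)[OF i] range[OF i] by (auto simp: a_def)
  qed
qed

text \<open>Serves to pass from consecutive elements of the chain to arbitrary pairs.\<close>

lemma increments_le_telescope:
  fixes h x :: "nat \<Rightarrow> real"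
  assumes "\<And>i. i \<in> {1..<m} \<Longrightarrow> x (Suc i) - x i \<le> h (Suc i) - h i"
    and "1 \<le> i" "i \<le> j" "j \<le> m"
  shows "x j - x i \<le> h j - h i"
  using assms(3,4)
proof (induction j rule: dec_induct)
  case (step j)
  then show ?case
    using assms(1)[of j] assms(2) by force
qed simp

text \<open>The triangle inequality bounds the absolute value at a convex combination, monotonicity
  carries this bound through \<Phi>, and convexity on the half-line finishes. This makes Jensen's
  inequality applicable to a real variable of either sign.\<close>

lemma convex_on_comp_abs:
  fixes \<Phi> :: "real \<Rightarrow> real"
  assumes conv: "convex_on {0..} \<Phi>" and mono: "mono_on {0..} \<Phi>"
  shows "convex_on UNIV (\<lambda>t. \<Phi> \<bar>t - c\<bar>)"
proof (rule convex_onI)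
  fix t x y :: real
  assume t: "0 < t" "t < 1"
  have "\<bar>(1 - t) *\<^sub>R x + t *\<^sub>R y - c\<bar> = \<bar>(1 - t) * (x - c) + t * (y - c)\<bar>"
    by (simp add: algebra_simps)
  also have "\<dots> \<le> (1 - t) * \<bar>x - c\<bar> + t * \<bar>y - c\<bar>"
    using t by (intro order_trans[OF abs_triangle_ineq]) (simp add: abs_mult)
  finally have "\<Phi> \<bar>(1 - t) *\<^sub>R x + t *\<^sub>R y - c\<bar> \<le> \<Phi> ((1 - t) * \<bar>x - c\<bar> + t * \<bar>y - c\<bar>)"
    using t by (intro mono_onD[OF mono]) auto
  also have "\<dots> \<le> (1 - t) * \<Phi> \<bar>x - c\<bar> + t * \<Phi> \<bar>y - c\<bar>"
    using convex_onD[OF conv, of t "\<bar>x - c\<bar>" "\<bar>y - c\<bar>"] t by simp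
  finally show "\<Phi> \<bar>(1 - t) *\<^sub>R x + t *\<^sub>R y - c\<bar> \<le> (1 - t) * \<Phi> \<bar>x - c\<bar> + t * \<Phi> \<bar>y - c\<bar>" .
qed auto

section \<open>Conditioning on events and on a finite-valued random element\<close>

context prob_space
begin

text \<open>\<open>uniform_measure M B\<close> is the conditional probability given
  \<open>B\<close>, so its integral is the elementary conditional mean. Both claims follow from its
  density, the indicator of \<open>B\<close> divided by \<open>prob B\<close>.\<close>

lemma integrable_uniform_measure:
  fixes f :: "'a \<Rightarrow> real"
  assumes "integrable M f" and "B \<in> events" and "0 < prob B"
  shows "integrable (uniform_measure M B) f"
    and "(\<integral>x. f x \<partial>uniform_measure M B) = (LINT x:B|M. f x) / prob B"
proof -
  have [measurable]: "f \<in> borel_measurable M" "B \<in> events"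
    using assms by auto
  have dens: "uniform_measure M B = density M (\<lambda>x. ennreal (indicator B x / prob B))"
    unfolding uniform_measure_def using assms(3)
    by (intro arg_cong[where f = "density M"] ext)
       (auto simp: emeasure_eq_measure divide_ennreal[of 1 "prob B", simplified] split: split_indicator)
  have int: "integrable M (\<lambda>x. indicator B x * f x)"
    using integrable_mult_indicator[OF assms(2,1)] by simp
  then have "integrable M (\<lambda>x. (indicator B x * f x) / prob B)"
    by simp
  then show "integrable (uniform_measure M B) f"
    unfolding dens using assms(3) by (subst integrable_density) auto
  have "(\<integral>x. f x \<partial>uniform_measure M B) = (\<integral>x. (indicator B x * f x) / prob B \<partial>M)"
    unfolding dens using assms(3) by (subst integral_density) auto
  then show "(\<integral>x. f x \<partial>uniform_measure M B) = (LINT x:B|M. f x) / prob B"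
    by (simp add: set_lebesgue_integral_def)
qed

text \<open>Jensen's inequality for the conditional probability given \<open>B\<close>, multiplied
  by \<open>prob B\<close> so that the bounds for disjoint events can be added.\<close>

lemma jensens_inequality_event:
  fixes f q :: "_ \<Rightarrow> real"
  assumes "integrable M f" and "integrable M (\<lambda>x. q (f x))" and "convex_on UNIV q"
    and B: "B \<in> events" "0 < prob B"
  shows "q ((LINT x:B|M. f x) / prob B) * prob B \<le> (LINT x:B|M. q (f x))"
proof -
  interpret B: prob_space "uniform_measure M B"
    using B by (intro prob_space_uniform_measure) (auto simp: emeasure_eq_measure)
  have "q ((LINT x:B|M. f x) / prob B) \<le> (LINT x:B|M. q (f x)) / prob B"
    using B.jensens_inequality[of f UNIV _ _ q] assms
    by (simp add: integrable_uniform_measure)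
  then show ?thesis
    using B by (simp add: field_simps)
qed

lemma integrable_comp_finite:
  fixes f :: "'s \<Rightarrow> real"
  assumes "finite E" and W: "W \<in> measurable M (count_space E)"
  shows "integrable M (\<lambda>x. f (W x))"
proof -
  have "(\<lambda>x. f (W x)) \<in> borel_measurable M"
    using W by (rule measurable_compose) simp
  moreover have "AE x in M. norm (f (W x)) \<le> (\<Sum>z\<in>E. \<bar>f z\<bar>)"
    using assms(1) measurable_space[OF W]
    by (intro AE_I2) (auto intro!: member_le_sum[of _ E "\<lambda>z. \<bar>f z\<bar>"])
  ultimately show ?thesis
    by (rule integrable_const_bound[rotated])
qed

text \<open>Writes a mean over an event through point probabilities, the form in which the shift
  property of the transformation is given. The event may depend on more than \<open>W\<close>: it is
  applied to the transformed element on an event described by the original one.\<close>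

lemma set_integral_comp_finite:
  fixes f :: "'s \<Rightarrow> real"
  assumes "finite E" and W: "W \<in> measurable M (count_space E)"
    and [measurable]: "Measurable.pred M P"
  shows "(LINT x:{x \<in> space M. P x}|M. f (W x)) = (\<Sum>z\<in>E. f z * \<P>(x in M. W x = z \<and> P x))"
proof -
  note W[measurable]
  have meas: "{x \<in> space M. W x = z \<and> P x} \<in> events" if "z \<in> E" for z
  proof -
    have "{x \<in> space M. W x = z \<and> P x} = (W -` {z} \<inter> space M) \<inter> {x \<in> space M. P x}"
      by auto
    moreover have "W -` {z} \<inter> space M \<in> events"
      using that by (intro measurable_sets[OF W]) auto
    ultimately show ?thesis
      by simp
  qed
  have "(LINT x:{x \<in> space M. P x}|M. f (W x))
      = (\<integral>x. (\<Sum>z\<in>E. f z * indicator {x \<in> space M. W x = z \<and> P x} x) \<partial>M)"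
    unfolding set_lebesgue_integral_def
  proof (rule Bochner_Integration.integral_cong[OF refl])
    fix x
    assume x: "x \<in> space M"
    have "(\<Sum>z\<in>E. f z * indicator {x \<in> space M. W x = z \<and> P x} x)
        = (\<Sum>z\<in>E. if z = W x then f z * indicator {x \<in> space M. P x} x else 0)"
      using x by (intro sum.cong) (auto split: split_indicator)
    also have "\<dots> = f (W x) * indicator {x \<in> space M. P x} x"
      using assms(1) measurable_space[OF W x] by simp
    finally show "indicator {x \<in> space M. P x} x *\<^sub>R f (W x)
        = (\<Sum>z\<in>E. f z * indicator {x \<in> space M. W x = z \<and> P x} x)"
      by simp
  qed
  also have "\<dots> = (\<Sum>z\<in>E. f z * \<P>(x in M. W x = z \<and> P x))"
    using meas by (subst Bochner_Integration.integral_sum) (auto simp: emeasure_eq_measure)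
  finally show ?thesis .
qed

text \<open>The event \<open>B\<close> belongs to the sigma-algebra generated by \<open>W\<close>,
  so on it \<open>g\<close> may be replaced by its conditional expectation. That is at least
  \<open>e\<close> off the bad event and almost surely at least \<open>-A\<close>
  everywhere.\<close>

lemma set_integral_ge_of_cond_exp_given:
  fixes g :: "'a \<Rightarrow> real"
  assumes W: "W \<in> measurable M (count_space E)" and g: "integrable M g"
    and lower: "\<And>x. x \<in> space M \<Longrightarrow> - A \<le> g x" and "0 \<le> A" "0 \<le> e"
    and "G \<subseteq> E"
  defines "B \<equiv> {x \<in> space M. W x \<in> G}"
  shows "e * prob B - (e + A) * \<P>(x in M. cond_exp_given M E W g x < e) \<le> (LINT x:B|M. g x)"
proof -
  define F where "F = vimage_algebra (space M) W (count_space E)"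
  define C where "C = cond_exp_given M E W g"
  have sub: "subalgebra M F"
    using W measurable_space[OF W] unfolding subalgebra_def F_def
    by (auto simp: sets_vimage_algebra2 measurable_sets)
  interpret finite_measure_subalgebra M F
    by standard (rule sub)
  have C_eq: "C = real_cond_exp M F g"
    by (simp add: C_def cond_exp_given_def F_def)
  have [measurable]: "C \<in> borel_measurable M"
    by (simp add: C_eq)
  have C_int: "integrable M C"
    unfolding C_eq using g by (rule real_cond_exp_int)
  have "B = W -` G \<inter> space M"
    by (auto simp: B_def)
  then have BF: "B \<in> sets F"
    using \<open>G \<subseteq> E\<close> by (auto simp: F_def intro: in_vimage_algebra)
  then have [measurable]: "B \<in> events"
    using sub by (auto simp: subalgebra_def)
  have C_ge: "AE x in M. - A \<le> C x"
    unfolding C_eq using g lower by (intro real_cond_exp_ge_c) auto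
  let ?bad = "{x \<in> space M. C x < e}"
  have "e * prob B - (e + A) * prob ?bad = (\<integral>x. e * indicator B x - (e + A) * indicator ?bad x \<partial>M)"
    by (subst Bochner_Integration.integral_diff) (auto simp: emeasure_eq_measure)
  also have "\<dots> \<le> (\<integral>x. indicator B x * C x \<partial>M)"
  proof (rule integral_mono_AE)
    show "integrable M (\<lambda>x. e * indicator B x - (e + A) * indicator ?bad x)"
      by (intro Bochner_Integration.integrable_diff) (auto simp: emeasure_eq_measure)
    show "integrable M (\<lambda>x. indicator B x * C x)"
      using integrable_mult_indicator[OF \<open>B \<in> events\<close> C_int] by simp
    \<comment> \<open>On the good part of \<open>B\<close> the left side is \<open>e\<close>, on the
      bad part it is \<open>-A\<close>, and outside \<open>B\<close> it is at most 0. The bad event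
      therefore need not be intersected with \<open>B\<close>.\<close>
    show "AE x in M. e * indicator B x - (e + A) * indicator ?bad x \<le> indicator B x * C x"
      using C_ge by eventually_elim (use \<open>0 \<le> A\<close> \<open>0 \<le> e\<close> in \<open>auto split: split_indicator simp: B_def\<close>)
  qed
  also have "\<dots> = (LINT x:B|M. C x)"
    by (simp add: set_lebesgue_integral_def)
  also have "\<dots> = (LINT x:B|M. g x)"
    unfolding C_eq using real_cond_exp_intA[OF g BF] by simp
  finally show ?thesis
    by (simp add: C_def)
qed

section \<open>The lower bound for a fixed string length\<close>

text \<open>Stated for any function \<open>f\<close> on a finite state space and any real \<mu>,
  with \<open>W\<close> in the role of the transformed element. The hypothesis \<open>small\<close>
  is what the asymptotic condition on the bad event provides at a single large n.\<close>

lemma moment_ge_sum_over_chain: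
  fixes f :: "'s \<Rightarrow> real" and u :: "'s \<Rightarrow> int" and v :: "nat \<Rightarrow> int" and \<Phi> :: "real \<Rightarrow> real"
  assumes nonneg: "\<And>t. 0 \<le> t \<Longrightarrow> 0 \<le> \<Phi> t"
    and conv: "convex_on {0..} \<Phi>" and mono: "mono_on {0..} \<Phi>"
    and E: "finite E" and Z: "Z \<in> measurable M (count_space E)"
    and W: "W \<in> measurable M (count_space E)"
    and m: "2 \<le> m" and v: "strict_mono_on {1..m} v"
    and p: "0 < p" "\<And>i. i \<in> {1..m} \<Longrightarrow> p \<le> \<P>(x in M. u (Z x) = v i)"
    and shift: "\<And>i z. i \<in> {1..m - 1} \<Longrightarrow> z \<in> E \<Longrightarrow>
          \<P>(x in M. W x = z \<bar> u (Z x) = v i) = \<P>(x in M. Z x = z \<bar> u (Z x) = v (i + 1))"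
    and lower: "\<And>x. x \<in> space M \<Longrightarrow> - A \<le> f (W x) - f (Z x)" and A: "0 \<le> A" and e: "0 < e"
    and small: "(e + A) * \<P>(x in M. cond_exp_given M E Z (\<lambda>x. f (W x) - f (Z x)) x < e) \<le> e / 2 * p"
  shows "\<exists>a\<in>{real_of_int (v 1)..real_of_int (v m)}.
      (\<Sum>k\<in>v ` {1..m}. \<Phi> (e / 2 / real_of_int (max_gap m v) * \<bar>real_of_int k - a\<bar>)
          * \<P>(x in M. u (Z x) = k))
        \<le> (\<integral>x. \<Phi> \<bar>f (Z x) - \<mu>\<bar> \<partial>M)"
proof -
  define B where "B i = {x \<in> space M. u (Z x) = v i}" for i
  define h where "h i = (LINT x:B i|M. f (Z x)) / prob (B i)" for i
  define k where "k = real_of_int (max_gap m v)"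
  \<comment> \<open>A guaranteed slope: \<open>h\<close> rises by at least \<open>e / 2\<close> over
    each gap of length at most \<open>k\<close>, hence by at least \<open>c\<close> per unit of
    \<open>u\<close>.\<close>
  define c where "c = e / 2 / k"
  have pred[measurable]: "Measurable.pred M (\<lambda>x. u (Z x) = j)" for j
    using Z by (rule measurable_compose) simp
  have B_event[measurable]: "B i \<in> events" for i
    unfolding B_def by measurable
  have prob_pos: "0 < prob (B i)" if "i \<in> {1..m}" for i
    using p(1) p(2)[OF that] by (simp add: B_def)
  have int_Z: "integrable M (\<lambda>x. g (Z x))" and int_W: "integrable M (\<lambda>x. g (W x))"
    for g :: "'s \<Rightarrow> real"
    using E Z W by (auto intro: integrable_comp_finite)
  have gap: "real_of_int (v (Suc i) - v i) \<le> k" if "i \<in> {1..<m}" for i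
    unfolding k_def max_gap_def of_int_le_iff using that by (intro Max_ge) force+
  have "v 1 < v (Suc 1)"
    using m by (intro strict_mono_onD[OF v]) auto
  then have k: "0 < k"
    using gap[of 1] m by simp
  then have c: "0 < c"
    using e by (simp add: c_def)
  have h_step: "e / 2 \<le> h (Suc i) - h i" if i: "i \<in> {1..<m}" for i
  proof -
    have pos: "0 < prob (B i)" and p_le: "p \<le> prob (B i)"
      using i p(2)[of i] prob_pos[of i] by (auto simp: B_def)
    \<comment> \<open>The shift property trades the law of \<open>Z\<close> on level
      \<open>i + 1\<close> for the law of \<open>W\<close> on level \<open>i\<close>, so that both
      means are taken over the same event \<open>B i\<close>.\<close>
    have "h (Suc i) = (\<Sum>z\<in>E. f z * \<P>(x in M. Z x = z \<bar> u (Z x) = v (i + 1)))"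
      unfolding h_def B_def set_integral_comp_finite[OF E Z pred]
      by (simp add: cond_prob_def sum_divide_distrib)
    also have "\<dots> = (\<Sum>z\<in>E. f z * \<P>(x in M. W x = z \<bar> u (Z x) = v i))"
      using shift[of i] i by (intro sum.cong) auto
    also have "\<dots> = (LINT x:B i|M. f (W x)) / prob (B i)"
      unfolding B_def set_integral_comp_finite[OF E W pred]
      by (simp add: cond_prob_def sum_divide_distrib)
    finally have "(h (Suc i) - h i) * prob (B i) = (LINT x:B i|M. f (W x)) - (LINT x:B i|M. f (Z x))"
      using pos by (simp add: h_def field_simps)
    also have "\<dots> = (LINT x:B i|M. f (W x) - f (Z x))"
      using integrable_mult_indicator[OF B_event int_W] integrable_mult_indicator[OF B_event int_Z]
      by (subst set_integral_diff) (auto simp: set_integrable_def)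
    also have "\<dots> \<ge> e * prob (B i) - e / 2 * p"
    proof -
      \<comment> \<open>Exhibits \<open>B i\<close> as an event about the value of \<open>Z\<close>,
        as the conditional-expectation bound requires.\<close>
      have B_eq: "B i = {x \<in> space M. Z x \<in> {z \<in> E. u z = v i}}"
        using measurable_space[OF Z] by (auto simp: B_def)
      have "e * prob (B i)
          - (e + A) * \<P>(x in M. cond_exp_given M E Z (\<lambda>x. f (W x) - f (Z x)) x < e)
          \<le> (LINT x:B i|M. f (W x) - f (Z x))"
        unfolding B_eq using Z
      proof (rule set_integral_ge_of_cond_exp_given)
        show "integrable M (\<lambda>x. f (W x) - f (Z x))"
          by (intro Bochner_Integration.integrable_diff int_W int_Z)
      qed (use lower A e in auto)
      then show ?thesis
        using small by linarith
    qed
    finally have "e * prob (B i) - e / 2 * p \<le> (h (Suc i) - h i) * prob (B i)" .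
    \<comment> \<open>Since \<open>p\<close> is a lower bound for \<open>prob (B i)\<close>, the
      error from the bad event costs at most half of the gain \<open>e * prob (B i)\<close>; this is
      where the factor 1/2 in the slope comes from.\<close>
    moreover have "e / 2 * p \<le> e / 2 * prob (B i)"
      using p_le e by simp
    ultimately have "e / 2 * prob (B i) \<le> (h (Suc i) - h i) * prob (B i)"
      by linarith
    then show ?thesis
      using pos by simp
  qed
  have growth: "c * real_of_int (v j) - c * real_of_int (v i) \<le> h j - h i"
    if "1 \<le> i" "i \<le> j" "j \<le> m" for i j
  proof (rule increments_le_telescope[OF _ that])
    fix i
    assume i: "i \<in> {1..<m}"
    have "c * real_of_int (v (Suc i) - v i) \<le> c * k"
      using gap[OF i] c by (intro mult_left_mono) auto
    also have "\<dots> = e / 2"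
      using k by (simp add: c_def)
    finally show "c * real_of_int (v (Suc i)) - c * real_of_int (v i) \<le> h (Suc i) - h i"
      using h_step[OF i] by (simp add: algebra_simps)
  qed
  have v_mono: "v i \<le> v j" if "1 \<le> i" "i \<le> j" "j \<le> m" for i j
    using strict_mono_on_leD[OF v] that by simp
  obtain a where a: "a \<in> {real_of_int (v 1)..real_of_int (v m)}"
    and close: "\<And>i. i \<in> {1..m} \<Longrightarrow> \<bar>real_of_int (v i) - a\<bar> \<le> \<bar>h i - \<mu>\<bar> / c"
  proof (rule common_point_of_pairwise_meeting_intervals
      [of "{1..m}" "\<lambda>i. \<bar>h i - \<mu>\<bar> / c" "v 1" "\<lambda>i. v i" "v m"])
    fix i j
    assume ij: "i \<in> {1..m}" "j \<in> {1..m}"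
    \<comment> \<open>Pairs come in both orders. For \<open>j \<le> i\<close> this is the growth of
      \<open>h\<close>; otherwise the left side is nonpositive. The triangle inequality through
      \<mu> then gives the meeting condition.\<close>
    have "c * (real_of_int (v i) - real_of_int (v j)) \<le> \<bar>h i - h j\<bar>"
    proof (cases "j \<le> i")
      case True
      then show ?thesis
        using growth[of j i] ij by (simp add: algebra_simps)
    next
      case False
      then have "c * (real_of_int (v i) - real_of_int (v j)) \<le> 0"
        using v_mono[of i j] ij c by (intro mult_nonneg_nonpos) auto
      then show ?thesis
        by linarith
    qed
    also have "\<dots> \<le> \<bar>h i - \<mu>\<bar> + \<bar>h j - \<mu>\<bar>"
      by linarith
    finally show "real_of_int (v i) - real_of_int (v j) \<le> \<bar>h i - \<mu>\<bar> / c + \<bar>h j - \<mu>\<bar> / c"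
      using c by (simp add: field_simps)
  qed (use m c v_mono in auto)
  have inj: "inj_on v {1..m}"
    using v by (rule strict_mono_on_imp_inj_on)
  have int_\<Phi>: "integrable M (\<lambda>x. \<Phi> \<bar>f (Z x) - \<mu>\<bar>)"
    by (rule int_Z)
  have "(\<Sum>j\<in>v ` {1..m}. \<Phi> (c * \<bar>real_of_int j - a\<bar>) * \<P>(x in M. u (Z x) = j))
      = (\<Sum>i\<in>{1..m}. \<Phi> (c * \<bar>real_of_int (v i) - a\<bar>) * prob (B i))"
    using inj by (simp add: sum.reindex B_def)
  also have "\<dots> \<le> (\<Sum>i\<in>{1..m}. LINT x:B i|M. \<Phi> \<bar>f (Z x) - \<mu>\<bar>)"
  proof (rule sum_mono)
    fix i
    assume i: "i \<in> {1..m}"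
    have "\<Phi> (c * \<bar>real_of_int (v i) - a\<bar>) \<le> \<Phi> \<bar>h i - \<mu>\<bar>"
      using close[OF i] c by (intro mono_onD[OF mono]) (auto simp: field_simps)
    then have "\<Phi> (c * \<bar>real_of_int (v i) - a\<bar>) * prob (B i) \<le> \<Phi> \<bar>h i - \<mu>\<bar> * prob (B i)"
      by (intro mult_right_mono) auto
    also have "\<dots> \<le> (LINT x:B i|M. \<Phi> \<bar>f (Z x) - \<mu>\<bar>)"
      unfolding h_def
      using int_Z int_\<Phi> convex_on_comp_abs[OF conv mono] B_event prob_pos[OF i]
      by (rule jensens_inequality_event)
    finally show "\<Phi> (c * \<bar>real_of_int (v i) - a\<bar>) * prob (B i) \<le> (LINT x:B i|M. \<Phi> \<bar>f (Z x) - \<mu>\<bar>)" .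
  qed
  also have "\<dots> = (LINT x:(\<Union>i\<in>{1..m}. B i)|M. \<Phi> \<bar>f (Z x) - \<mu>\<bar>)"
  proof (rule set_integral_finite_Union[symmetric])
    show "disjoint_family_on B {1..m}"
    proof (unfold disjoint_family_on_def, intro ballI impI)
      fix i j
      assume "i \<in> {1..m}" "j \<in> {1..m}" "i \<noteq> j"
      then have "v i \<noteq> v j"
        using inj_on_eq_iff[OF inj] by blast
      then show "B i \<inter> B j = {}"
        by (auto simp: B_def)
    qed
    show "set_integrable M (B i) (\<lambda>x. \<Phi> \<bar>f (Z x) - \<mu>\<bar>)" for i
      unfolding set_integrable_def by (rule integrable_mult_indicator[OF B_event int_\<Phi>])
  qed (rule finite_atLeastAtMost, rule B_event)
  \<comment> \<open>The chain may miss some values of \<open>u (Z x)\<close>; outside the union of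
    the \<open>B i\<close> the integrand is nonnegative.\<close>
  also have "\<dots> \<le> (\<integral>x. \<Phi> \<bar>f (Z x) - \<mu>\<bar> \<partial>M)"
    unfolding set_lebesgue_integral_def
  proof (rule integral_mono)
    have "(\<Union>i\<in>{1..m}. B i) \<in> events"
      by (intro sets.finite_UN) auto
    then show "integrable M (\<lambda>x. indicator (\<Union>i\<in>{1..m}. B i) x *\<^sub>R \<Phi> \<bar>f (Z x) - \<mu>\<bar>)"
      using int_\<Phi> by (rule integrable_mult_indicator)
    show "indicator (\<Union>i\<in>{1..m}. B i) x *\<^sub>R \<Phi> \<bar>f (Z x) - \<mu>\<bar> \<le> \<Phi> \<bar>f (Z x) - \<mu>\<bar>" for x
      using nonneg[of "\<bar>f (Z x) - \<mu>\<bar>"] by (simp add: indicator_def)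
  qed (rule int_\<Phi>)
  finally show ?thesis
    using a unfolding c_def k_def by blast
qed

end

section \<open>Optimal alignment scores and large string lengths\<close>

text \<open>The space \<open>M n\<close> carries both \<open>Z n\<close> and the extra randomness
  \<open>\<xi> n\<close>, which has law \<open>\<Omega> n\<close> and is independent of
  \<open>Z n\<close>. The transformed pair thus becomes an ordinary random element
  \<open>RZ n\<close>, and conditioning on \<open>Z n\<close> averages over
  \<open>\<xi> n\<close>.\<close>

theorem theorem3p4:
  fixes Alph :: "'a set" and S :: "'a \<Rightarrow> 'a \<Rightarrow> real" and \<theta> :: real
    and XX :: "nat \<Rightarrow> 'a list set"
    and M :: "nat \<Rightarrow> 'w measure" and X Y :: "nat \<Rightarrow> 'w \<Rightarrow> 'a list"
    and Z :: "nat \<Rightarrow> 'w \<Rightarrow> 'a list \<times> 'a list"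
    and L :: "nat \<Rightarrow> 'a list \<times> 'a list \<Rightarrow> real"
    and u :: "nat \<Rightarrow> 'a list \<times> 'a list \<Rightarrow> int" and U :: "nat \<Rightarrow> 'w \<Rightarrow> int"
    and m :: "nat \<Rightarrow> nat" and v :: "nat \<Rightarrow> nat \<Rightarrow> int" and \<U> :: "nat \<Rightarrow> int set"
    and \<Omega> :: "nat \<Rightarrow> 'r measure" and \<xi> :: "nat \<Rightarrow> 'w \<Rightarrow> 'r"
    and R :: "nat \<Rightarrow> 'r \<Rightarrow> 'a list \<times> 'a list \<Rightarrow> 'a list \<times> 'a list"
    and RZ :: "nat \<Rightarrow> 'w \<Rightarrow> 'a list \<times> 'a list"
    and \<phi> \<Delta> \<mu> :: "nat \<Rightarrow> real" and k0 :: "nat \<Rightarrow> int"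
    and A \<epsilon>0 \<delta> :: real and \<Phi> :: "real \<Rightarrow> real"
  defines "Z \<equiv> \<lambda>n \<omega>. (X n \<omega>, Y n \<omega>)"
    and "L \<equiv> \<lambda>n. optimal_score S \<theta> n"
    and "U \<equiv> \<lambda>n \<omega>. u n (Z n \<omega>)"
    and "\<U> \<equiv> \<lambda>n. v n ` {1..m n}"
    and "RZ \<equiv> \<lambda>n \<omega>. R n (\<xi> n \<omega>) (Z n \<omega>)"
    and "\<Delta> \<equiv> \<lambda>n. \<P>(\<omega> in M n. cond_exp_given (M n) (XX n \<times> XX n) (Z n)
                      (\<lambda>\<omega>'. L n (RZ n \<omega>') - L n (Z n \<omega>')) \<omega> < \<epsilon>0)"
    and "\<mu> \<equiv> \<lambda>n. \<integral>\<omega>. L n (Z n \<omega>) \<partial>M n"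
    and "k0 \<equiv> \<lambda>n. max_gap (m n) (v n)"
    and "\<delta> \<equiv> \<epsilon>0 / 2"
  assumes \<Phi>_nonneg: "\<And>t. t \<ge> 0 \<Longrightarrow> \<Phi> t \<ge> 0"
    and \<Phi>_convex: "convex_on {0..} \<Phi>"
    and \<Phi>_mono: "mono_on {0..} \<Phi>"
    and alphabet: "finite Alph"
    and S_nonneg: "\<And>a b. a \<in> Alph \<Longrightarrow> b \<in> Alph \<Longrightarrow> S a b \<ge> 0"
    and S_sym: "\<And>a b. a \<in> Alph \<Longrightarrow> b \<in> Alph \<Longrightarrow> S a b = S b a"
    and sample_space: "\<And>n. n \<ge> 1 \<Longrightarrow> XX n \<subseteq> {w. set w \<subseteq> Alph \<and> length w = n}"
    and prob: "\<And>n. n \<ge> 1 \<Longrightarrow> prob_space (M n)"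
    and X_meas: "\<And>n. n \<ge> 1 \<Longrightarrow> X n \<in> measurable (M n) (count_space (XX n))"
    and Y_meas: "\<And>n. n \<ge> 1 \<Longrightarrow> Y n \<in> measurable (M n) (count_space (XX n))"
    and XY_indep: "\<And>n. n \<ge> 1 \<Longrightarrow>
          prob_space.indep_var (M n) (count_space (XX n)) (X n) (count_space (XX n)) (Y n)"
    and XY_ident: "\<And>n. n \<ge> 1 \<Longrightarrow>
          distr (M n) (count_space (XX n)) (X n) = distr (M n) (count_space (XX n)) (Y n)"
    and m_ge_2: "\<And>n. n \<ge> 1 \<Longrightarrow> m n \<ge> 2"
    and v_increasing: "\<And>n. n \<ge> 1 \<Longrightarrow> strict_mono_on {1..m n} (v n)"
    and support: "\<And>n. n \<ge> 1 \<Longrightarrow> \<U> n \<subseteq> {k. \<P>(\<omega> in M n. U n \<omega> = k) > 0}"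
    and R_transformation: "\<And>n. n \<ge> 1 \<Longrightarrow> random_transformation (\<Omega> n) (XX n \<times> XX n) (R n)"
    and \<xi>_meas: "\<And>n. n \<ge> 1 \<Longrightarrow> \<xi> n \<in> measurable (M n) (\<Omega> n)"
    and \<xi>_distr: "\<And>n. n \<ge> 1 \<Longrightarrow> distr (M n) (\<Omega> n) (\<xi> n) = \<Omega> n"
    and \<xi>_indep: "\<And>n. n \<ge> 1 \<Longrightarrow>
          indep_elements (M n) (\<Omega> n) (\<xi> n) (count_space (XX n \<times> XX n)) (Z n)"
    and R_shift: "\<And>n i z. n \<ge> 1 \<Longrightarrow> i \<in> {1..m n - 1} \<Longrightarrow> z \<in> XX n \<times> XX n \<Longrightarrow>
          \<P>(\<omega> in M n. RZ n \<omega> = z \<bar> U n \<omega> = v n i)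
            = \<P>(\<omega> in M n. Z n \<omega> = z \<bar> U n \<omega> = v n (i + 1))"
    and A_pos: "A > 0"
    and bounded_decrease: "\<And>n \<omega>. n \<ge> 1 \<Longrightarrow> \<omega> \<in> space (M n) \<Longrightarrow>
          L n (RZ n \<omega>) - L n (Z n \<omega>) \<ge> - A"
    and \<epsilon>0_pos: "\<epsilon>0 > 0"
    and \<phi>_pos: "\<And>n. n \<ge> 1 \<Longrightarrow> \<phi> n > 0"
    and \<phi>_lower: "\<And>n k. n \<ge> 1 \<Longrightarrow> k \<in> \<U> n \<Longrightarrow> \<P>(\<omega> in M n. U n \<omega> = k) \<ge> \<phi> n"
    and \<Delta>_small: "\<Delta> \<in> o[sequentially](\<phi>)"
  shows "\<exists>a :: nat \<Rightarrow> real.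
      (\<forall>n\<ge>1. a n \<in> {real_of_int (v n 1)..real_of_int (v n (m n))}) \<and>
      (\<forall>\<^sub>F n in sequentially.
        (\<integral>\<omega>. \<Phi> \<bar>L n (Z n \<omega>) - \<mu> n\<bar> \<partial>M n)
          \<ge> (\<Sum>k\<in>\<U> n. \<Phi> (\<delta> / real_of_int (k0 n) * \<bar>real_of_int k - a n\<bar>)
                      * \<P>(\<omega> in M n. U n \<omega> = k)) \<and>
        (\<Sum>k\<in>\<U> n. \<Phi> (\<delta> / real_of_int (k0 n) * \<bar>real_of_int k - a n\<bar>)
                      * \<P>(\<omega> in M n. U n \<omega> = k))
          \<ge> (\<Sum>k\<in>\<U> n. \<Phi> (\<delta> / real_of_int (k0 n) * \<bar>real_of_int k - a n\<bar>) * \<phi> n))"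
proof -
  define good where "good n \<longleftrightarrow> (\<epsilon>0 + A) * \<Delta> n \<le> \<epsilon>0 / 2 * \<phi> n" for n
  \<comment> \<open>The range condition is demanded for every \<open>n \<ge> 1\<close>, the moment
    bound only when \<open>good n\<close> holds; with both in one predicate, a single choice of the
    sequence \<open>a\<close> serves both claims.\<close>
  define centre where "centre n a \<longleftrightarrow> a \<in> {real_of_int (v n 1)..real_of_int (v n (m n))} \<and>
      (good n \<longrightarrow>
        (\<Sum>k\<in>\<U> n. \<Phi> (\<delta> / real_of_int (k0 n) * \<bar>real_of_int k - a\<bar>) * \<P>(\<omega> in M n. U n \<omega> = k))
          \<le> (\<integral>\<omega>. \<Phi> \<bar>L n (Z n \<omega>) - \<mu> n\<bar> \<partial>M n))" for n a
  have "\<exists>a. n \<ge> 1 \<longrightarrow> centre n a" for n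
  proof (cases "n \<ge> 1 \<and> good n")
    case True
    then have n: "n \<ge> 1" and good: "good n"
      by auto
    interpret prob_space "M n"
      by (rule prob[OF n])
    let ?E = "XX n \<times> XX n"
    have XX: "finite (XX n)"
      using finite_subset[OF sample_space[OF n] finite_lists_length_eq[OF alphabet]] .
    \<comment> \<open>By finiteness the product sigma-algebra is discrete, which makes the pair
      \<open>Z n\<close> measurable into \<open>count_space ?E\<close>.\<close>
    have prod: "count_space (XX n) \<Otimes>\<^sub>M count_space (XX n) = count_space ?E"
      using XX by (simp add: pair_measure_count_space)
    have Z_meas: "Z n \<in> measurable (M n) (count_space ?E)"
      unfolding Z_def prod[symmetric] by (intro measurable_Pair X_meas[OF n] Y_meas[OF n])
    have "RZ n = (\<lambda>(r, z). R n r z) \<circ> (\<lambda>\<omega>. (\<xi> n \<omega>, Z n \<omega>))"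
      by (auto simp: RZ_def)
    also have "\<dots> \<in> measurable (M n) (count_space ?E)"
      using R_transformation[OF n] unfolding random_transformation_def
      by (intro measurable_comp[OF measurable_Pair[OF \<xi>_meas[OF n] Z_meas]]) auto
    finally have RZ_meas: "RZ n \<in> measurable (M n) (count_space ?E)" .
    have "\<exists>a\<in>{real_of_int (v n 1)..real_of_int (v n (m n))}.
      (\<Sum>k\<in>v n ` {1..m n}. \<Phi> (\<epsilon>0 / 2 / real_of_int (max_gap (m n) (v n)) * \<bar>real_of_int k - a\<bar>)
          * \<P>(\<omega> in M n. u n (Z n \<omega>) = k))
        \<le> (\<integral>\<omega>. \<Phi> \<bar>L n (Z n \<omega>) - \<mu> n\<bar> \<partial>M n)"
    proof (rule moment_ge_sum_over_chain[OF \<Phi>_nonneg \<Phi>_convex \<Phi>_mono _ Z_meas RZ_meas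
          m_ge_2[OF n] v_increasing[OF n] \<phi>_pos[OF n]])
      show "\<phi> n \<le> \<P>(\<omega> in M n. u n (Z n \<omega>) = v n i)" if "i \<in> {1..m n}" for i
        using \<phi>_lower[OF n, of "v n i"] that by (simp add: \<U>_def U_def)
      show "\<P>(\<omega> in M n. RZ n \<omega> = z \<bar> u n (Z n \<omega>) = v n i)
          = \<P>(\<omega> in M n. Z n \<omega> = z \<bar> u n (Z n \<omega>) = v n (i + 1))"
        if "i \<in> {1..m n - 1}" "z \<in> ?E" for i z
        using R_shift[OF n that] by (simp add: U_def)
      show "- A \<le> L n (RZ n \<omega>) - L n (Z n \<omega>)" if "\<omega> \<in> space (M n)" for \<omega>
        by (rule bounded_decrease[OF n that])
      show "(\<epsilon>0 + A) * \<P>(\<omega> in M n. cond_exp_given (M n) ?E (Z n)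
          (\<lambda>\<omega>. L n (RZ n \<omega>) - L n (Z n \<omega>)) \<omega> < \<epsilon>0) \<le> \<epsilon>0 / 2 * \<phi> n"
        using good by (simp add: good_def \<Delta>_def)
    qed (use XX A_pos \<epsilon>0_pos in auto)
    then show ?thesis
      unfolding centre_def \<delta>_def k0_def \<U>_def U_def by blast
  next
    case False
    \<comment> \<open>Without \<open>good n\<close> only the range condition remains, and the left
      endpoint satisfies it.\<close>
    have "v n 1 \<le> v n (m n)" if "n \<ge> 1"
      using strict_mono_on_leD[OF v_increasing[OF that]] m_ge_2[OF that] by simp
    then show ?thesis
      using False by (intro exI[of _ "real_of_int (v n 1)"]) (auto simp: centre_def)
  qed
  then obtain a where a: "\<And>n. n \<ge> 1 \<Longrightarrow> centre n (a n)"
    by metis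
  \<comment> \<open>Chosen so that \<open>(\<epsilon>0 + A) * q = \<epsilon>0 / 2\<close>: the
    little-o condition with constant \<open>q\<close> then yields \<open>good n\<close> for all
    large n.\<close>
  define q where "q = \<epsilon>0 / (2 * (\<epsilon>0 + A))"
  have q: "0 < q"
    using \<epsilon>0_pos A_pos by (simp add: q_def)
  have "\<forall>\<^sub>F n in sequentially. n \<ge> 1 \<and> good n"
    using landau_o.smallD[OF \<Delta>_small q] eventually_ge_at_top[of 1]
  proof eventually_elim
    case (elim n)
    then have "\<Delta> n \<le> q * \<phi> n"
      using \<phi>_pos[of n] by (simp add: abs_le_iff)
    then have "(\<epsilon>0 + A) * \<Delta> n \<le> (\<epsilon>0 + A) * (q * \<phi> n)"
      using \<epsilon>0_pos A_pos by (intro mult_left_mono) auto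
    also have "\<dots> = \<epsilon>0 / 2 * \<phi> n"
    proof -
      have "(\<epsilon>0 + A) * q = \<epsilon>0 / 2"
        using \<epsilon>0_pos A_pos by (simp add: q_def field_simps)
      then show ?thesis
        by (metis mult.assoc)
    qed
    finally show ?case
      using elim by (simp add: good_def)
  qed
  then have "\<forall>\<^sub>F n in sequentially.
        (\<integral>\<omega>. \<Phi> \<bar>L n (Z n \<omega>) - \<mu> n\<bar> \<partial>M n)
          \<ge> (\<Sum>k\<in>\<U> n. \<Phi> (\<delta> / real_of_int (k0 n) * \<bar>real_of_int k - a n\<bar>)
                      * \<P>(\<omega> in M n. U n \<omega> = k)) \<and>
        (\<Sum>k\<in>\<U> n. \<Phi> (\<delta> / real_of_int (k0 n) * \<bar>real_of_int k - a n\<bar>)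
                      * \<P>(\<omega> in M n. U n \<omega> = k))
          \<ge> (\<Sum>k\<in>\<U> n. \<Phi> (\<delta> / real_of_int (k0 n) * \<bar>real_of_int k - a n\<bar>) * \<phi> n)"
  proof eventually_elim
    case (elim n)
    then have n: "n \<ge> 1"
      by simp
    \<comment> \<open>The first gap is positive, hence so is \<open>k0 n\<close>. The arguments of
      \<Phi> are then nonnegative, as needed for its values to be nonnegative weights in the second
      inequality.\<close>
    have "v n 1 < v n (Suc 1)"
      using m_ge_2[OF n] by (intro strict_mono_onD[OF v_increasing[OF n]]) auto
    also have "v n (Suc 1) - v n 1 \<le> k0 n"
      unfolding k0_def max_gap_def using m_ge_2[OF n] by (intro Max_ge) force+
    finally have "0 \<le> \<delta> / real_of_int (k0 n)"
      using \<epsilon>0_pos by (simp add: \<delta>_def)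
    then have "(\<Sum>k\<in>\<U> n. \<Phi> (\<delta> / real_of_int (k0 n) * \<bar>real_of_int k - a n\<bar>) * \<phi> n)
        \<le> (\<Sum>k\<in>\<U> n. \<Phi> (\<delta> / real_of_int (k0 n) * \<bar>real_of_int k - a n\<bar>) * \<P>(\<omega> in M n. U n \<omega> = k))"
      by (intro sum_mono mult_left_mono \<phi>_lower[OF n] \<Phi>_nonneg mult_nonneg_nonneg) auto
    then show ?case
      using a[OF n] elim unfolding centre_def by blast
  qed
  moreover have "\<forall>n\<ge>1. a n \<in> {real_of_int (v n 1)..real_of_int (v n (m n))}"
    using a by (simp add: centre_def)
  ultimately show ?thesis
    by blast
qed

end
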